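(* Let $B=(\beta_{ij})_{ij}\in S(n)$ satisfy $$\beta_{ii}>0\qquad\text{and}\qquad\sum_{j=1,\,j\ne i}^n\beta_{ij}^->-\beta_{ii}\qquad\text{for }i=1,\dots,n,$$ where $\beta_{ij}^-=\min\{\beta_{ij},0\}$. Then $B$ is strictly cubically copositive, and therefore, for $N\in\{1,2,3\}$, the system $$-\Delta u_i=\sum_{j=1}^n\beta_{ij}u_j^2u_i,\qquad u_1,\dots,u_n\ge 0\qquad\text{in }\mathbb{R}^N\qquad(i=1,\dots,n)$$ does not admit a nontrivial solution.
   Context: $S(n)$ denotes the space of symmetric $n\times n$ matrices with real coefficients, and $C^n_+=\{c\in\mathbb{R}^n: c_i\ge 0 \text{ for all } i\}$. A matrix $B=(\beta_{ij})_{ij}\in S(n)$ is called strictly cubically copositive if there exists $\mu\in C^n_+$ such that $\sum_{i,j=1}^n\beta_{ij}c_j^2c_i\mu_i>0$ for all $c\in C^n_+\setminus\{0\}$. A solution $u=(u_1,\dots,u_n)$ of the system (all components nonnegative) is called nontrivial if $u_i\not\equiv 0$ for at least one $i$. *)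

theory Defs
  imports "HOL-Analysis.Analysis"
begin

definition nonneg_cone :: "(real ^ 'n) set" where
  "nonneg_cone = {c. \<forall>i. 0 \<le> c $ i}"

definition strictly_cubically_copositive :: "real ^ 'n ^ 'n \<Rightarrow> bool" where
  "strictly_cubically_copositive B \<longleftrightarrow>
     (\<exists>\<mu>\<in>nonneg_cone. \<forall>c\<in>nonneg_cone - {0}.
        (\<Sum>i\<in>UNIV. \<Sum>j\<in>UNIV. B $ i $ j * (c $ j)\<^sup>2 * c $ i * \<mu> $ i) > 0)"

definition partial_deriv :: "'m \<Rightarrow> (real ^ 'm \<Rightarrow> real) \<Rightarrow> real ^ 'm \<Rightarrow> real" where
  "partial_deriv k f x = deriv (\<lambda>t. f (x + t *\<^sub>R axis k 1)) 0"

(* deriv is an unspecified value where no derivative exists, so the existence of the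
   derivatives up to second order has to be demanded here explicitly. *)
definition C2_function :: "(real ^ 'm \<Rightarrow> real) \<Rightarrow> bool" where
  "C2_function f \<longleftrightarrow>
     f differentiable_on UNIV \<and>
     (\<forall>k. partial_deriv k f differentiable_on UNIV) \<and>
     (\<forall>k l. continuous_on UNIV (partial_deriv l (partial_deriv k f)))"

definition laplacian :: "(real ^ 'm \<Rightarrow> real) \<Rightarrow> real ^ 'm \<Rightarrow> real" where
  "laplacian f x = (\<Sum>k\<in>UNIV. partial_deriv k (partial_deriv k f) x)"

(* Classical (C^2) entire solutions with nonnegative components. *)
definition nonneg_cubic_system_solution ::
    "real ^ 'n ^ 'n \<Rightarrow> ('n \<Rightarrow> real ^ 'm \<Rightarrow> real) \<Rightarrow> bool" where
  "nonneg_cubic_system_solution B u \<longleftrightarrow>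
     (\<forall>i. C2_function (u i)) \<and>
     (\<forall>i x. 0 \<le> u i x) \<and>
     (\<forall>i x. - laplacian (u i) x = (\<Sum>j\<in>UNIV. B $ i $ j * (u j x)\<^sup>2 * u i x))"

definition nontrivial :: "('n \<Rightarrow> real ^ 'm \<Rightarrow> real) \<Rightarrow> bool" where
  "nontrivial u \<longleftrightarrow> (\<exists>i. u i \<noteq> (\<lambda>x. 0))"

end

theory Submission
  imports Defs "HOL-Real_Asymp.Real_Asymp"
begin

text \<open>
  Copositivity holds with all weights \<open>\<mu>\<^sub>i = 1\<close>. Dropping the positive off-diagonal entries only
  decreases the cubic form, and Young's inequality bounds the mixed term
  \<open>c\<^sub>j\<^sup>2 c\<^sub>i\<close> by \<open>(2 c\<^sub>j\<^sup>3 + c\<^sub>i\<^sup>3) / 3\<close>; since the matrix is symmetric, both cubes collect the same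
  row sum, and what remains is a combination of the \<open>c\<^sub>i\<^sup>3\<close> with positive coefficients.

  By homogeneity and compactness of the part of the unit sphere in the cone, copositivity improves
  to a bound \<open>\<ge> \<kappa> |c|\<^sup>3\<close>. Hence the weighted sum \<open>w = \<Sum> \<mu>\<^sub>i u\<^sub>i\<close> of a solution is a nonnegative entire
  supersolution \<open>- \<Delta> w \<ge> \<delta> w\<^sup>3\<close> with \<open>\<delta> > 0\<close>. In dimension at most 3 the exponent 3 does not exceed
  the critical exponent \<open>N / (N - 2)\<close> (infinite for \<open>N \<le> 2\<close>), and such a supersolution must vanish. Once \<open>w = 0\<close>, the
  coercive bound forces every component of \<open>u\<close> to vanish as well, even where \<open>\<mu>\<^sub>i = 0\<close>.

  The vanishing of \<open>w\<close> uses the minimum principle alone, which involves only second derivatives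
  along the coordinate axes. Suppose \<open>w > 0\<close> at the centre \<open>a\<close>, and let \<open>r\<close> be the distance to \<open>a\<close>.
  Comparison with \<open>1 / r\<close> gives \<open>w \<ge> b / r\<close> outside a ball of some radius \<open>\<rho>\<close>. Then
  \<open>- \<Delta> w \<ge> \<delta> b\<^sup>3 / r\<^sup>3\<close>, and the critical power \<open>r\<^sup>-\<^sup>3\<close> produces a logarithm:
  \<open>w \<ge> A ln (r / \<rho>) / r\<close> (lemma \<open>logarithmic_lower_bound\<close>). On the other hand,
  the nonlinearity pushes the minimum over a ball up when the ball is halved, while comparison with
  \<open>1 / r\<close> shows that it at most doubles; so \<open>R\<close> times the minimum of \<open>w\<close> over the ball of radius
  \<open>R\<close> stays bounded (lemma \<open>universal_upper_bound\<close>). For large \<open>R\<close> the two bounds are incompatible.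
\<close>

section \<open>The Laplacian as a sum of second derivatives along the axes\<close>

text \<open>
  A relational form of the Laplacian, pointwise and with the value as an argument, so that it can be
  computed compositionally and applied to comparison functions that are singular at a point. The
  first derivatives are required only near the base point.
\<close>

definition has_laplacian :: "(real ^ 'm \<Rightarrow> real) \<Rightarrow> real \<Rightarrow> real ^ 'm \<Rightarrow> bool" where
  "has_laplacian f L x \<longleftrightarrow>
     (\<exists>p q. (\<forall>k. (\<forall>\<^sub>F t in nhds 0.
                    ((\<lambda>t. f (x + t *\<^sub>R axis k 1)) has_real_derivative p k t) (at t)) \<and>
                 (p k has_real_derivative q k) (at 0)) \<and>
            L = (\<Sum>k\<in>UNIV. q k))"

lemma has_laplacianI:
  assumes "\<And>k. \<forall>\<^sub>F t in nhds 0.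
             ((\<lambda>t. f (x + t *\<^sub>R axis k 1)) has_real_derivative p k t) (at t)"
    and "\<And>k. (p k has_real_derivative q k) (at 0)"
    and "L = (\<Sum>k\<in>UNIV. q k)"
  shows "has_laplacian f L x"
  unfolding has_laplacian_def using assms by (intro exI[of _ p] exI[of _ q]) auto

lemma has_laplacian_const: "has_laplacian (\<lambda>x. c) 0 x"
  by (rule has_laplacianI[where p = "\<lambda>_ _. 0" and q = "\<lambda>_. 0"]) auto

lemma has_laplacian_add:
  assumes "has_laplacian f L x" "has_laplacian g M x"
  shows "has_laplacian (\<lambda>x. f x + g x) (L + M) x"
proof -
  obtain p q where f:
    "\<And>k. \<forall>\<^sub>F t in nhds 0. ((\<lambda>t. f (x + t *\<^sub>R axis k 1)) has_real_derivative p k t) (at t)"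
    "\<And>k. (p k has_real_derivative q k) (at 0)" "L = (\<Sum>k\<in>UNIV. q k)"
    using assms(1) unfolding has_laplacian_def by blast
  obtain p' q' where g:
    "\<And>k. \<forall>\<^sub>F t in nhds 0. ((\<lambda>t. g (x + t *\<^sub>R axis k 1)) has_real_derivative p' k t) (at t)"
    "\<And>k. (p' k has_real_derivative q' k) (at 0)" "M = (\<Sum>k\<in>UNIV. q' k)"
    using assms(2) unfolding has_laplacian_def by blast
  show ?thesis
  proof (rule has_laplacianI[where p = "\<lambda>k t. p k t + p' k t" and q = "\<lambda>k. q k + q' k"])
    show "\<forall>\<^sub>F t in nhds 0. ((\<lambda>t. f (x + t *\<^sub>R axis k 1) + g (x + t *\<^sub>R axis k 1))
            has_real_derivative p k t + p' k t) (at t)" for k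
      using eventually_conj[OF f(1)[of k] g(1)[of k]]
      by eventually_elim (auto intro: DERIV_add)
    show "((\<lambda>t. p k t + p' k t) has_real_derivative q k + q' k) (at 0)" for k
      by (rule DERIV_add[OF f(2) g(2)])
  qed (simp add: f(3) g(3) sum.distrib)
qed

lemma has_laplacian_cmult:
  assumes "has_laplacian f L x"
  shows "has_laplacian (\<lambda>x. c * f x) (c * L) x"
proof -
  obtain p q where f:
    "\<And>k. \<forall>\<^sub>F t in nhds 0. ((\<lambda>t. f (x + t *\<^sub>R axis k 1)) has_real_derivative p k t) (at t)"
    "\<And>k. (p k has_real_derivative q k) (at 0)" "L = (\<Sum>k\<in>UNIV. q k)"
    using assms(1) unfolding has_laplacian_def by blast
  show ?thesis
  proof (rule has_laplacianI[where p = "\<lambda>k t. c * p k t" and q = "\<lambda>k. c * q k"])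
    show "\<forall>\<^sub>F t in nhds 0. ((\<lambda>t. c * f (x + t *\<^sub>R axis k 1))
            has_real_derivative c * p k t) (at t)" for k
      using f(1)[of k] by eventually_elim (auto intro: DERIV_cmult)
    show "((\<lambda>t. c * p k t) has_real_derivative c * q k) (at 0)" for k
      by (rule DERIV_cmult[OF f(2)])
  qed (simp add: f(3) sum_distrib_left)
qed

lemma has_laplacian_diff:
  assumes "has_laplacian f L x" "has_laplacian g M x"
  shows "has_laplacian (\<lambda>x. f x - g x) (L - M) x"
  using has_laplacian_add[OF assms(1) has_laplacian_cmult[OF assms(2), of "-1"]] by simp

lemma has_laplacian_sum:
  assumes "finite A" "\<And>i. i \<in> A \<Longrightarrow> has_laplacian (f i) (L i) x"
  shows "has_laplacian (\<lambda>x. \<Sum>i\<in>A. f i x) (\<Sum>i\<in>A. L i) x"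
  using assms by (induction A) (auto intro: has_laplacian_const has_laplacian_add)

lemma differentiable_imp_axis_derivative:
  fixes f :: "real ^ 'm \<Rightarrow> real"
  assumes "f differentiable_on UNIV"
  shows "((\<lambda>t. f (x + t *\<^sub>R axis k 1))
           has_real_derivative partial_deriv k f (x + t *\<^sub>R axis k 1)) (at t)"
proof -
  have *: "(\<lambda>t. f (y + t *\<^sub>R axis k 1)) differentiable at s" for y s
  proof -
    have "(f \<circ> (\<lambda>t. y + t *\<^sub>R axis k 1)) differentiable at s"
    proof (rule differentiable_chain_at)
      show "(\<lambda>t. y + t *\<^sub>R axis k 1) differentiable at s"
        by (intro derivative_intros)
      show "f differentiable at (y + s *\<^sub>R axis k 1)"
        using assms by (simp add: differentiable_on_def)
    qed
    then show ?thesis by (simp add: o_def)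
  qed
  have "((\<lambda>s. f ((x + t *\<^sub>R axis k 1) + s *\<^sub>R axis k 1))
          has_real_derivative partial_deriv k f (x + t *\<^sub>R axis k 1)) (at 0)"
    unfolding partial_deriv_def
    using * by (simp add: DERIV_deriv_iff_real_differentiable)
  then have "((\<lambda>s. f (x + (t + s) *\<^sub>R axis k 1))
          has_real_derivative partial_deriv k f (x + t *\<^sub>R axis k 1)) (at 0)"
    by (simp add: scaleR_left_distrib add.assoc)
  then show ?thesis
    using DERIV_at_within_shift[of "\<lambda>s. f (x + s *\<^sub>R axis k 1)" _ t 0 UNIV]
    by (simp add: add.commute)
qed

lemma C2_function_has_laplacian:
  assumes "C2_function f"
  shows "has_laplacian f (laplacian f x) x"
proof (rule has_laplacianI[where p = "\<lambda>k t. partial_deriv k f (x + t *\<^sub>R axis k 1)"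
      and q = "\<lambda>k. partial_deriv k (partial_deriv k f) x"])
  show "\<forall>\<^sub>F t in nhds 0. ((\<lambda>t. f (x + t *\<^sub>R axis k 1))
          has_real_derivative partial_deriv k f (x + t *\<^sub>R axis k 1)) (at t)" for k
    using assms unfolding C2_function_def
    by (intro always_eventually allI differentiable_imp_axis_derivative) auto
  show "((\<lambda>t. partial_deriv k f (x + t *\<^sub>R axis k 1))
          has_real_derivative partial_deriv k (partial_deriv k f) x) (at 0)" for k
    using differentiable_imp_axis_derivative[of "partial_deriv k f" x k 0] assms
    unfolding C2_function_def by auto
qed (simp add: laplacian_def)

lemma inner_axis_shift:
  "(x + t *\<^sub>R axis k 1 - a) \<bullet> (x + t *\<^sub>R axis k 1 - a) =
     (norm (x - a))\<^sup>2 + 2 * t * (x - a) $ k + t\<^sup>2" for x a :: "real ^ 'm"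
proof -
  have "x + t *\<^sub>R axis k 1 - a = (x - a) + t *\<^sub>R axis k 1" by simp
  also have "\<dots> \<bullet> \<dots> = (x - a) \<bullet> (x - a) + 2 * t * ((x - a) \<bullet> axis k 1)
      + t\<^sup>2 * (axis k 1 \<bullet> axis k (1::real))"
    by (simp add: inner_add_left inner_add_right inner_commute power2_eq_square algebra_simps
        del: inner_axis_axis)
  finally show ?thesis
    by (simp add: power2_norm_eq_inner inner_axis inner_axis_axis)
qed

lemma has_laplacian_norm_squared:
  fixes x a :: "real ^ 'm"
  shows "has_laplacian (\<lambda>x. (norm (x - a))\<^sup>2) (2 * real CARD('m)) x"
proof (rule has_laplacianI[where p = "\<lambda>k t. 2 * (x - a) $ k + 2 * t" and q = "\<lambda>k. 2"])
  show "\<forall>\<^sub>F t in nhds 0. ((\<lambda>t. (norm (x + t *\<^sub>R axis k 1 - a))\<^sup>2)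
          has_real_derivative 2 * (x - a) $ k + 2 * t) (at t)" for k
    unfolding power2_norm_eq_inner inner_axis_shift
    by (intro always_eventually allI) (auto intro!: derivative_eq_intros)
qed (auto intro!: derivative_eq_intros)

text \<open>
  The usual formula \<open>g'' + (N - 1) g' / r\<close>. With \<open>y = x - a\<close>, the second derivative along the
  \<open>k\<close>-th axis is \<open>g'' y\<^sub>k\<^sup>2 / r\<^sup>2 + g' (1 / r - y\<^sub>k\<^sup>2 / r\<^sup>3)\<close>, and the \<open>y\<^sub>k\<^sup>2\<close> add up to \<open>r\<^sup>2\<close>.
\<close>

lemma has_laplacian_radial:
  fixes x a :: "real ^ 'm"
  assumes "x \<noteq> a"
    and g': "\<And>r. r > 0 \<Longrightarrow> (g has_real_derivative g' r) (at r)"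
    and g'': "(g' has_real_derivative g'') (at (norm (x - a)))"
  shows "has_laplacian (\<lambda>x. g (norm (x - a)))
           (g'' + (real CARD('m) - 1) / norm (x - a) * g' (norm (x - a))) x"
proof -
  define R where "R = norm (x - a)"
  have R: "R > 0" using assms(1) by (simp add: R_def)
  define y where "y = x - a"
  define r where "r k t = sqrt (R\<^sup>2 + 2 * t * y $ k + t\<^sup>2)" for k t
  have r: "norm (x + t *\<^sub>R axis k 1 - a) = r k t" for k t
    unfolding r_def y_def R_def norm_eq_sqrt_inner[of "x + t *\<^sub>R axis k 1 - a"] inner_axis_shift ..
  have r0: "r k 0 = R" for k using R by (simp add: r_def)
  have r': "(r k has_real_derivative (y $ k + t) / r k t) (at t)" if "r k t > 0" for k t
  proof -
    define s where "s t = R\<^sup>2 + 2 * t * y $ k + t\<^sup>2" for t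
    have r_eq: "r k = (\<lambda>t. sqrt (s t))" by (simp add: r_def s_def fun_eq_iff)
    have "s t > 0" using that by (simp add: r_eq)
    moreover have "(s has_real_derivative 2 * (y $ k + t)) (at t)"
      unfolding s_def by (auto intro!: derivative_eq_intros)
    ultimately have "(r k has_real_derivative inverse (sqrt (s t)) / 2 * (2 * (y $ k + t))) (at t)"
      unfolding r_eq by (intro DERIV_chain2[OF DERIV_real_sqrt])
    moreover have "inverse u / 2 * (2 * v) = v / u" for u v :: real
      by (cases "u = 0") (auto simp: field_simps)
    ultimately show ?thesis by (simp only: r_eq)
  qed
  have rc: "isCont (r k) 0" for k
    using r'[of k 0] r0 R by (auto intro: DERIV_isCont)
  have rpos: "\<forall>\<^sub>F t in nhds 0. r k t > 0" for k
  proof -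
    have "(r k \<longlongrightarrow> R) (nhds 0)"
      using rc[of k, unfolded isCont_def tendsto_at_iff_tendsto_nhds] by (simp add: r0)
    then show ?thesis using R by (rule order_tendstoD(1))
  qed
  show ?thesis
    unfolding R_def[symmetric]
  proof (rule has_laplacianI[where p = "\<lambda>k t. g' (r k t) * ((y $ k + t) / r k t)"
      and q = "\<lambda>k. (g'' * (y $ k / R)) * (y $ k / R) + g' R * (1 / R - (y $ k)\<^sup>2 / R ^ 3)"])
    show "\<forall>\<^sub>F t in nhds 0. ((\<lambda>t. g (norm (x + t *\<^sub>R axis k 1 - a)))
            has_real_derivative g' (r k t) * ((y $ k + t) / r k t)) (at t)" for k
      using rpos[of k] unfolding r
      by eventually_elim (rule DERIV_chain2[OF g' r'])
    show "((\<lambda>t. g' (r k t) * ((y $ k + t) / r k t)) has_real_derivative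
       (g'' * (y $ k / R)) * (y $ k / R) + g' R * (1 / R - (y $ k)\<^sup>2 / R ^ 3)) (at 0)" for k
    proof -
      have 1: "((\<lambda>t. g' (r k t)) has_real_derivative g'' * (y $ k / R)) (at 0)"
        using DERIV_chain2[of g' g'' "r k" 0, OF _ r'[of k 0]] g'' r0 R by (simp add: R_def)
      have 2: "((\<lambda>t. (y $ k + t) / r k t) has_real_derivative
          (1 / R - (y $ k)\<^sup>2 / R ^ 3)) (at 0)"
      proof (rule DERIV_cong[OF DERIV_divide[OF _ r'[of k 0]]])
        show "((\<lambda>t. y $ k + t) has_real_derivative 1) (at 0)"
          by (auto intro!: derivative_eq_intros)
        show "(1 * r k 0 - (y $ k + 0) * ((y $ k + 0) / r k 0)) / (r k 0 * r k 0) =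
            1 / R - (y $ k)\<^sup>2 / R ^ 3"
          unfolding r0 using R by (simp add: field_simps power2_eq_square power3_eq_cube)
      qed (use r0 R in auto)
      show ?thesis
        by (rule DERIV_cong[OF DERIV_mult[OF 1 2]]) (simp add: r0 algebra_simps)
    qed
    have y2: "(\<Sum>k\<in>UNIV. (y $ k)\<^sup>2) = R\<^sup>2"
      unfolding R_def y_def power2_norm_eq_inner by (simp add: inner_vec_def power2_eq_square)
    have "(\<Sum>k\<in>UNIV. (g'' * (y $ k / R)) * (y $ k / R) + g' R * (1 / R - (y $ k)\<^sup>2 / R ^ 3))
      = (\<Sum>k\<in>UNIV. (g'' / R\<^sup>2 - g' R / R ^ 3) * (y $ k)\<^sup>2 + g' R / R)"
      by (intro sum.cong) (auto simp: algebra_simps power2_eq_square)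
    also have "\<dots> = (g'' / R\<^sup>2 - g' R / R ^ 3) * R\<^sup>2 + real CARD('m) * (g' R / R)"
      by (simp only: sum.distrib sum_distrib_left[symmetric] y2) simp
    also have "\<dots> = g'' + (real CARD('m) - 1) / R * g' R"
      using R by (simp add: field_simps power2_eq_square power3_eq_cube)
    finally show "g'' + (real CARD('m) - 1) / R * g' R =
      (\<Sum>k\<in>UNIV. (g'' * (y $ k / R)) * (y $ k / R) + g' R * (1 / R - (y $ k)\<^sup>2 / R ^ 3))" ..
  qed
qed

section \<open>The minimum principle\<close>

text \<open>
  The first derivative vanishes at the minimum; if its own derivative were negative there, it would
  be negative just to the right, and by the mean value theorem the function would drop below its
  minimum.
\<close>

lemma second_derivative_nonneg_at_local_min:
  fixes f p :: "real \<Rightarrow> real"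
  assumes min: "\<forall>\<^sub>F t in nhds 0. f 0 \<le> f t"
    and p: "\<forall>\<^sub>F t in nhds 0. (f has_real_derivative p t) (at t)"
    and q: "(p has_real_derivative q) (at 0)"
  shows "q \<ge> 0"
proof (rule ccontr)
  assume "\<not> q \<ge> 0"
  then have "q < 0" by simp
  obtain e where e: "e > 0"
    "\<And>t. \<bar>t\<bar> < e \<Longrightarrow> f 0 \<le> f t \<and> (f has_real_derivative p t) (at t)"
    using eventually_conj[OF min p] unfolding eventually_nhds_metric by (auto simp: dist_real_def)
  have p0: "p 0 = 0"
    using DERIV_local_min[of f "p 0" 0 e] e by simp
  obtain d where d: "d > 0" "\<And>h. 0 < h \<Longrightarrow> h < d \<Longrightarrow> p h < 0"
    using DERIV_neg_dec_right[OF q \<open>q < 0\<close>] p0 by auto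
  define h where "h = min d e / 2"
  have h: "0 < h" "h < d" "h < e" using d(1) e(1) by (auto simp: h_def)
  have "\<exists>z. 0 < z \<and> z < h \<and> f h - f 0 = (h - 0) * p z"
    using h e by (intro MVT2) auto
  then obtain z where z: "0 < z" "z < h" "f h - f 0 = h * p z" by auto
  have "p z < 0" using d z h by simp
  then have "f h - f 0 < 0" using z h by (simp add: mult_pos_neg)
  moreover have "f 0 \<le> f h" using e(2)[of h] h by simp
  ultimately show False by simp
qed

lemma laplacian_nonneg_at_local_min:
  fixes f :: "real ^ 'm \<Rightarrow> real"
  assumes "has_laplacian f L x" "open U" "x \<in> U" "\<And>y. y \<in> U \<Longrightarrow> f x \<le> f y"
  shows "L \<ge> 0"
proof -
  obtain p q where f:
    "\<And>k. \<forall>\<^sub>F t in nhds 0. ((\<lambda>t. f (x + t *\<^sub>R axis k 1)) has_real_derivative p k t) (at t)"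
    "\<And>k. (p k has_real_derivative q k) (at 0)" "L = (\<Sum>k\<in>UNIV. q k)"
    using assms(1) unfolding has_laplacian_def by blast
  have "q k \<ge> 0" for k
  proof (rule second_derivative_nonneg_at_local_min[OF _ f(1,2)])
    have "((\<lambda>t. x + t *\<^sub>R axis k 1) \<longlongrightarrow> x) (nhds (0::real))"
      by (rule tendsto_eq_intros refl filterlim_ident | simp)+
    then have "\<forall>\<^sub>F t in nhds 0. x + t *\<^sub>R axis k 1 \<in> U"
      using assms(2,3) by (simp add: tendsto_def)
    then show "\<forall>\<^sub>F t in nhds 0. f (x + 0 *\<^sub>R axis k 1) \<le> f (x + t *\<^sub>R axis k 1)"
      by eventually_elim (simp add: assms(4))
  qed
  then show ?thesis by (simp add: f(3) sum_nonneg)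
qed

text \<open>
  If \<open>z\<close> were negative somewhere, adding a small multiple of the concave function
  \<open>C\<^sup>2 - |y|\<^sup>2\<close>, nonnegative on \<open>K\<close>, would keep the minimum negative, hence in \<open>U\<close>, while making the
  Laplacian strictly negative there; this contradicts the second derivative test.
\<close>

lemma weak_minimum_principle:
  fixes z :: "real ^ 'm \<Rightarrow> real"
  assumes "compact K" "continuous_on K z" "open U" "U \<subseteq> K"
    and lap: "\<And>x. x \<in> U \<Longrightarrow> \<exists>L\<le>0. has_laplacian z L x"
    and bd: "\<And>x. x \<in> K - U \<Longrightarrow> z x \<ge> 0"
    and "x \<in> K"
  shows "z x \<ge> 0"
proof (rule ccontr)
  assume "\<not> z x \<ge> 0"
  then have neg: "z x < 0" by simp
  obtain C where C: "C > 0" "\<And>y. y \<in> K \<Longrightarrow> norm y \<le> C"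
    using compact_imp_bounded[OF \<open>compact K\<close>] bounded_pos by metis
  \<comment> \<open>the perturbation is at most \<open>e C\<^sup>2\<close>, half the depth of the negative value at \<open>x\<close>\<close>
  define e where "e = - z x / (2 * C\<^sup>2)"
  have e: "e > 0" "e * C\<^sup>2 = - z x / 2" using neg C by (auto simp: e_def field_simps)
  define f where "f y = z y + e * (C\<^sup>2 - (norm (y - 0))\<^sup>2)" for y
  have "continuous_on K f" unfolding f_def
    by (intro continuous_intros \<open>continuous_on K z\<close>)
  then obtain m where m: "m \<in> K" "\<And>y. y \<in> K \<Longrightarrow> f m \<le> f y"
    using continuous_attains_inf[OF \<open>compact K\<close>, of f] \<open>x \<in> K\<close> by blast
  have ge: "f y \<ge> z y" if "y \<in> K" for y
    using C(2)[OF that] e(1) by (auto simp: f_def intro!: mult_nonneg_nonneg power_mono)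
  have "f x \<le> z x + e * C\<^sup>2" using e(1) by (simp add: f_def)
  then have "f m < 0" using m(2)[OF \<open>x \<in> K\<close>] e(2) neg by linarith
  then have "m \<in> U" using bd[of m] ge[of m] m(1) by force
  then obtain L where L: "L \<le> 0" "has_laplacian z L m" using lap by blast
  have "has_laplacian f (L + e * (0 - 2 * real CARD('m))) m"
    unfolding f_def
    by (intro has_laplacian_add L has_laplacian_cmult has_laplacian_diff has_laplacian_const
        has_laplacian_norm_squared)
  from laplacian_nonneg_at_local_min[OF this \<open>open U\<close> \<open>m \<in> U\<close>] m(2) \<open>U \<subseteq> K\<close>
  have "L + e * (0 - 2 * real CARD('m)) \<ge> 0" by blast
  moreover have "e * real CARD('m) > 0" using e(1) by simp
  ultimately show False using L(1) by (simp add: algebra_simps)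
qed

text \<open>
  The minimum principle for \<open>w - v\<close> in the form in which radial barriers, singular at
  the centre, are used below.
\<close>

lemma annulus_comparison:
  fixes w v :: "real ^ 'm \<Rightarrow> real"
  assumes "continuous_on UNIV w" "0 < \<rho>" "continuous_on (- {a}) v"
    and lap: "\<And>x. \<rho> < norm (x - a) \<Longrightarrow>
        \<exists>L M. has_laplacian w L x \<and> has_laplacian v M x \<and> L \<le> M"
    and inner: "\<And>x. norm (x - a) = \<rho> \<Longrightarrow> v x \<le> w x"
    and outer: "\<And>x. norm (x - a) = R \<Longrightarrow> v x \<le> w x"
    and "\<rho> \<le> norm (x - a)" "norm (x - a) \<le> R"
  shows "v x \<le> w x"
proof -
  have "w x - v x \<ge> 0"
  proof (rule weak_minimum_principle[where K = "cball a R - ball a \<rho>"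
        and U = "ball a R - cball a \<rho>" and z = "\<lambda>x. w x - v x"])
    show "compact (cball a R - ball a \<rho>)" by (intro compact_diff) auto
    have "cball a R - ball a \<rho> \<subseteq> - {a}" using \<open>0 < \<rho>\<close> by auto
    then show "continuous_on (cball a R - ball a \<rho>) (\<lambda>x. w x - v x)"
      by (intro continuous_on_diff) (auto intro: continuous_on_subset assms)
    show "\<exists>L\<le>0. has_laplacian (\<lambda>x. w x - v x) L y" if "y \<in> ball a R - cball a \<rho>" for y
    proof -
      have "\<rho> < norm (y - a)" using that by (auto simp: dist_norm norm_minus_commute)
      from lap[OF this] obtain L M where "has_laplacian w L y" "has_laplacian v M y" "L \<le> M"
        by blast
      then show ?thesis by (intro exI[of _ "L - M"]) (auto intro: has_laplacian_diff)
    qed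
    show "w y - v y \<ge> 0" if "y \<in> (cball a R - ball a \<rho>) - (ball a R - cball a \<rho>)" for y
      using that inner[of y] outer[of y] by (auto simp: dist_norm norm_minus_commute)
  qed (use assms(7,8) in \<open>auto simp: dist_norm norm_minus_commute\<close>)
  then show ?thesis by simp
qed

section \<open>Entire supersolutions of the cubic equation\<close>

locale cubic_supersolution =
  fixes w D :: "real ^ 'm \<Rightarrow> real" and \<delta> :: real
  assumes dim: "CARD('m) \<le> 3"
    and cont: "continuous_on UNIV w"
    and nonneg: "\<And>x. 0 \<le> w x"
    and lap: "\<And>x. has_laplacian w (D x) x"
    and \<delta>: "\<delta> > 0"
    and super: "\<And>x. \<delta> * w x ^ 3 \<le> - D x"
begin

lemma D_nonpos: "D x \<le> 0"
  using super[of x] \<delta> nonneg[of x] by (smt (verit) mult_nonneg_nonneg zero_le_power)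

text \<open>
  The barrier is a paraboloid with Laplacian \<open>- d N / 3\<close>, which is at least \<open>- d\<close> because
  \<open>N \<le> 3\<close>.
\<close>

lemma ball_comparison:
  assumes "0 \<le> d" "\<And>x. norm (x - a) \<le> R \<Longrightarrow> d \<le> - D x"
    and "\<And>x. norm (x - a) = R \<Longrightarrow> c \<le> w x"
    and "norm (x - a) \<le> R"
  shows "c + d / 6 * (R\<^sup>2 - (norm (x - a))\<^sup>2) \<le> w x"
proof -
  have "w x - (c + d / 6 * (R\<^sup>2 - (norm (x - a))\<^sup>2)) \<ge> 0"
  proof (rule weak_minimum_principle[where K = "cball a R" and U = "ball a R"
        and z = "\<lambda>x. w x - (c + d / 6 * (R\<^sup>2 - (norm (x - a))\<^sup>2))"])
    show "continuous_on (cball a R) (\<lambda>x. w x - (c + d / 6 * (R\<^sup>2 - (norm (x - a))\<^sup>2)))"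
      by (intro continuous_intros continuous_on_subset[OF cont]) auto
    show "\<exists>L\<le>0. has_laplacian (\<lambda>x. w x - (c + d / 6 * (R\<^sup>2 - (norm (x - a))\<^sup>2))) L y"
      if "y \<in> ball a R" for y
    proof (intro exI conjI)
      show "has_laplacian (\<lambda>x. w x - (c + d / 6 * (R\<^sup>2 - (norm (x - a))\<^sup>2)))
          (D y - (0 + d / 6 * (0 - 2 * real CARD('m)))) y"
        by (intro has_laplacian_add has_laplacian_cmult has_laplacian_diff has_laplacian_const
            has_laplacian_norm_squared lap)
      have "d * CARD('m) \<le> d * 3" using dim assms(1) by (intro mult_left_mono) auto
      moreover have "d \<le> - D y"
        using that assms(2)[of y] by (simp add: dist_norm norm_minus_commute)
      ultimately show "D y - (0 + d / 6 * (0 - 2 * real CARD('m))) \<le> 0" by simp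
    qed
    show "w y - (c + d / 6 * (R\<^sup>2 - (norm (y - a))\<^sup>2)) \<ge> 0" if "y \<in> cball a R - ball a R" for y
      using that assms(3)[of y] by (auto simp: dist_norm norm_minus_commute)
  qed (use assms(4) in \<open>auto simp: dist_norm norm_minus_commute\<close>)
  then show ?thesis by simp
qed

text \<open>
  The function \<open>1 / r\<close> has Laplacian \<open>(3 - N) / r\<^sup>3\<close>: it is harmonic for \<open>N = 3\<close> and subharmonic below,
  so a single barrier serves all three dimensions. It is shifted to vanish on a large sphere, whose
  radius then tends to infinity.
\<close>

lemma inverse_radius_lower_bound:
  assumes "0 < \<rho>" "0 \<le> c" "\<And>x. norm (x - a) = \<rho> \<Longrightarrow> c \<le> w x" "\<rho> \<le> norm (x - a)"
  shows "c * \<rho> / norm (x - a) \<le> w x"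
proof -
  have le: "c * \<rho> * (1 / norm (x - a) - 1 / R) \<le> w x" if R: "norm (x - a) \<le> R" for R
  proof (rule annulus_comparison[OF cont \<open>0 < \<rho>\<close>, where a = a
      and v = "\<lambda>x. c * \<rho> * (1 / norm (x - a) - 1 / R)" and R = R])
    have "0 < R" using assms(1,4) R by linarith
    show "continuous_on (- {a}) (\<lambda>x. c * \<rho> * (1 / norm (x - a) - 1 / R))"
      using \<open>0 < R\<close> by (intro continuous_intros) auto
    show "\<exists>L M. has_laplacian w L y \<and>
        has_laplacian (\<lambda>x. c * \<rho> * (1 / norm (x - a) - 1 / R)) M y \<and> L \<le> M"
      if y: "\<rho> < norm (y - a)" for y
    proof (intro exI conjI)
      show "has_laplacian w (D y) y" by (rule lap)
      let ?r = "norm (y - a)"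
      have r: "?r > 0" using y assms(1) by linarith
      have "has_laplacian (\<lambda>x. 1 / norm (x - a))
          (2 / ?r ^ 3 + (real CARD('m) - 1) / ?r * (- 1 / ?r\<^sup>2)) y"
        by (rule has_laplacian_radial[where g = "\<lambda>r. 1 / r" and g' = "\<lambda>r. - 1 / r\<^sup>2"])
          (use r in \<open>auto intro!: derivative_eq_intros
              simp: field_simps power2_eq_square power3_eq_cube\<close>)
      also have "2 / ?r ^ 3 + (real CARD('m) - 1) / ?r * (- 1 / ?r\<^sup>2) = (3 - real CARD('m)) / ?r ^ 3"
        using r by (simp add: field_simps power2_eq_square power3_eq_cube)
      finally show "has_laplacian (\<lambda>x. c * \<rho> * (1 / norm (x - a) - 1 / R))
          (c * \<rho> * ((3 - real CARD('m)) / ?r ^ 3 - 0)) y"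
        by (intro has_laplacian_cmult has_laplacian_diff has_laplacian_const)
      have "0 \<le> c * \<rho> * ((3 - real CARD('m)) / ?r ^ 3 - 0)"
        using dim assms by (intro mult_nonneg_nonneg) auto
      then show "D y \<le> c * \<rho> * ((3 - real CARD('m)) / ?r ^ 3 - 0)"
        using D_nonpos[of y] by linarith
    qed
    show "c * \<rho> * (1 / norm (y - a) - 1 / R) \<le> w y" if "norm (y - a) = \<rho>" for y
    proof -
      have "c * \<rho> * (1 / norm (y - a) - 1 / R) = c - c * \<rho> / R"
        using that assms(1) by (simp add: field_simps)
      also have "\<dots> \<le> c" using assms(1,2) \<open>0 < R\<close> by simp
      finally show ?thesis using assms(3)[OF that] by linarith
    qed
  qed (use assms R nonneg in auto)
  have "((\<lambda>R. c * \<rho> * (1 / norm (x - a) - 1 / R)) \<longlongrightarrow> c * \<rho> * (1 / norm (x - a) - 0)) at_top"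
    by (intro tendsto_intros tendsto_divide_0[OF tendsto_const]
        filterlim_at_top_imp_at_infinity filterlim_ident)
  then have "c * \<rho> * (1 / norm (x - a) - 0) \<le> w x"
    by (rule tendsto_upperbound)
      (auto intro: eventually_mono[OF eventually_ge_at_top[of "norm (x - a)"] le])
  then show ?thesis by simp
qed

text \<open>
  The barrier is \<open>\<psi> r = ln (r / \<rho>) / r\<close>, whose Laplacian in dimension 3 is exactly \<open>- 1 / r\<^sup>3\<close>, the decay
  rate that \<open>w \<ge> b / r\<close> induces on the nonlinear term. For \<open>1 \<le> N \<le> 3\<close> its Laplacian is still at least
  \<open>- 3 / r\<^sup>3\<close> beyond \<open>\<rho>\<close>, where the logarithm is nonnegative; this is the source of the divisor 3 in
  the constant.
\<close>

lemma logarithmic_lower_bound: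
  assumes "0 < \<rho>" "0 \<le> b" "\<And>x. \<rho> \<le> norm (x - a) \<Longrightarrow> b / norm (x - a) \<le> w x"
    and "\<rho> \<le> norm (x - a)"
  shows "\<delta> * b ^ 3 / 3 * (ln (norm (x - a) / \<rho>) / norm (x - a)) \<le> w x"
proof -
  define A where "A = \<delta> * b ^ 3 / 3"
  have A: "A \<ge> 0" using \<delta> assms(2) by (simp add: A_def)
  define \<psi> where "\<psi> r = ln (r / \<rho>) / r" for r
  have ln': "((\<lambda>s. ln (s / \<rho>)) has_real_derivative 1 / s) (at s)" if "s > 0" for s
    using that assms(1) by (auto intro!: derivative_eq_intros)
  have \<psi>': "(\<psi> has_real_derivative (1 - ln (s / \<rho>)) / s\<^sup>2) (at s)" if "s > 0" for s
    unfolding \<psi>_def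
    by (rule DERIV_cong[OF DERIV_divide[OF ln'[OF that] DERIV_ident]])
      (use that in \<open>simp_all add: power2_eq_square\<close>)
  have \<psi>'': "((\<lambda>s. (1 - ln (s / \<rho>)) / s\<^sup>2) has_real_derivative
      (2 * ln (s / \<rho>) - 3) / s ^ 3) (at s)" if "s > 0" for s
  proof (rule DERIV_cong[OF DERIV_divide[OF DERIV_diff[OF DERIV_const ln'[OF that]]]])
    show "((\<lambda>s. s\<^sup>2) has_real_derivative 2 * s) (at s)"
      by (auto intro!: derivative_eq_intros)
    show "((0 - 1 / s) * s\<^sup>2 - (1 - ln (s / \<rho>)) * (2 * s)) / (s\<^sup>2 * s\<^sup>2) =
        (2 * ln (s / \<rho>) - 3) / s ^ 3"
      using that by (simp add: divide_simps) (simp add: eval_nat_numeral algebra_simps)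
  qed (use that in auto)
  have le: "A * (\<psi> (norm (x - a)) - \<psi> R) \<le> w x" if R: "norm (x - a) \<le> R" for R
  proof (rule annulus_comparison[OF cont \<open>0 < \<rho>\<close>, where a = a
      and v = "\<lambda>x. A * (\<psi> (norm (x - a)) - \<psi> R)" and R = R])
    have "\<rho> \<le> R" "0 < R" using assms(1,4) R by linarith+
    then have \<psi>R: "\<psi> R \<ge> 0" using assms(1) by (simp add: \<psi>_def)
    show "continuous_on (- {a}) (\<lambda>x. A * (\<psi> (norm (x - a)) - \<psi> R))"
      unfolding \<psi>_def using \<open>0 < R\<close> \<open>0 < \<rho>\<close> by (intro continuous_intros) auto
    show "\<exists>L M. has_laplacian w L y \<and>
        has_laplacian (\<lambda>x. A * (\<psi> (norm (x - a)) - \<psi> R)) M y \<and> L \<le> M"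
      if y: "\<rho> < norm (y - a)" for y
    proof (intro exI conjI)
      show "has_laplacian w (D y) y" by (rule lap)
      define r where "r = norm (y - a)"
      define l where "l = ln (r / \<rho>)"
      have r: "r > 0" "r > \<rho>" using y assms(1) by (auto simp: r_def)
      have l: "l \<ge> 0" using r assms(1) by (simp add: l_def)
      have "has_laplacian (\<lambda>x. \<psi> (norm (x - a)))
          ((2 * l - 3) / r ^ 3 + (real CARD('m) - 1) / r * ((1 - l) / r\<^sup>2)) y"
        unfolding l_def r_def
        using y assms(1) r by (intro has_laplacian_radial \<psi>' \<psi>'') (auto simp: r_def)
      also have "(2 * l - 3) / r ^ 3 + (real CARD('m) - 1) / r * ((1 - l) / r\<^sup>2) =
          (real CARD('m) - 4 + (3 - real CARD('m)) * l) / r ^ 3"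
        using r by (simp add: field_simps power2_eq_square power3_eq_cube)
      finally show "has_laplacian (\<lambda>x. A * (\<psi> (norm (x - a)) - \<psi> R))
          (A * ((real CARD('m) - 4 + (3 - real CARD('m)) * l) / r ^ 3 - 0)) y"
        by (intro has_laplacian_cmult has_laplacian_diff has_laplacian_const)
      have "(3 - real CARD('m)) * l \<ge> 0" using dim l by simp
      moreover have "real CARD('m) \<ge> 1" by (simp add: Suc_leI)
      ultimately have "- 3 \<le> real CARD('m) - 4 + (3 - real CARD('m)) * l" by linarith
      then have "-3 / r ^ 3 \<le> (real CARD('m) - 4 + (3 - real CARD('m)) * l) / r ^ 3"
        using r by (intro divide_right_mono) auto
      then have "A * (-3 / r ^ 3) \<le> A * ((real CARD('m) - 4 + (3 - real CARD('m)) * l) / r ^ 3)"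
        using A by (rule mult_left_mono)
      moreover have "D y \<le> A * (-3 / r ^ 3)"
      proof -
        have "(b / r) ^ 3 \<le> w y ^ 3"
          using assms(2) assms(3)[of y] r by (intro power_mono) (auto simp: r_def)
        then have "\<delta> * (b / r) ^ 3 \<le> \<delta> * w y ^ 3" using \<delta> by simp
        then have "\<delta> * (b / r) ^ 3 \<le> - D y" using super[of y] by linarith
        then show ?thesis by (simp add: A_def power_divide)
      qed
      ultimately show "D y \<le> A * ((real CARD('m) - 4 + (3 - real CARD('m)) * l) / r ^ 3 - 0)"
        by simp
    qed
    show "A * (\<psi> (norm (y - a)) - \<psi> R) \<le> w y" if "norm (y - a) = \<rho>" for y
    proof -
      have "\<psi> (norm (y - a)) = 0" using that assms(1) by (simp add: \<psi>_def)
      then have "A * (\<psi> (norm (y - a)) - \<psi> R) \<le> 0" using A \<psi>R by simp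
      then show ?thesis using nonneg[of y] by linarith
    qed
  qed (use assms R nonneg in auto)
  have "(\<psi> \<longlongrightarrow> 0) at_top"
    unfolding \<psi>_def using assms(1) by real_asymp
  then have "((\<lambda>R. A * (\<psi> (norm (x - a)) - \<psi> R)) \<longlongrightarrow> A * (\<psi> (norm (x - a)) - 0)) at_top"
    by (intro tendsto_intros)
  then have "A * (\<psi> (norm (x - a)) - 0) \<le> w x"
    by (rule tendsto_upperbound)
      (auto intro: eventually_mono[OF eventually_ge_at_top[of "norm (x - a)"] le])
  then show ?thesis by (simp add: A_def \<psi>_def)
qed

text \<open>
  Let \<open>M\<close> be the minimum of \<open>w\<close> over the ball of radius \<open>R\<close>. There \<open>- \<Delta> w \<ge> \<delta> M\<^sup>3\<close>, so the paraboloid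
  barrier raises the lower bound on the ball of radius \<open>R / 2\<close> to
  \<open>c = M + \<delta> M\<^sup>3 R\<^sup>2 / 8\<close>. Comparison with \<open>1 / r\<close> carries half of this back to the whole ball,
  so \<open>c / 2 \<le> M\<close>, which bounds \<open>M R\<close>.
\<close>

lemma universal_upper_bound:
  assumes "0 < R" "0 < m" "\<And>x. norm (x - a) = R \<Longrightarrow> m \<le> w x"
  shows "\<delta> * (m * R)\<^sup>2 \<le> 8"
proof -
  have "\<exists>y\<in>cball a R. \<forall>x\<in>cball a R. w y \<le> w x"
    using \<open>0 < R\<close> by (intro continuous_attains_inf continuous_on_subset[OF cont]) auto
  then obtain y where y: "norm (y - a) \<le> R" "\<And>x. norm (x - a) \<le> R \<Longrightarrow> w y \<le> w x"
    by (force simp: dist_norm norm_minus_commute)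
  define M where "M = w y"
  have "m \<le> M"
    using ball_comparison[of 0 a R m y] D_nonpos assms(3) y(1) by (simp add: M_def)
  then have M: "M > 0" using assms(2) by linarith
  define c where "c = M + \<delta> * M ^ 3 * R\<^sup>2 / 8"
  have c: "c \<ge> 0" using M \<delta> by (simp add: c_def)
  have cw: "c \<le> w x" if x: "norm (x - a) \<le> R / 2" for x
  proof -
    have "M + \<delta> * M ^ 3 / 6 * (R\<^sup>2 - (norm (x - a))\<^sup>2) \<le> w x"
    proof (rule ball_comparison)
      show "\<delta> * M ^ 3 \<le> - D z" if "norm (z - a) \<le> R" for z
      proof -
        have "M ^ 3 \<le> w z ^ 3" using y(2)[OF that] M by (intro power_mono) (auto simp: M_def)
        then have "\<delta> * M ^ 3 \<le> \<delta> * w z ^ 3" using \<delta> by simp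
        then show ?thesis using super[of z] by linarith
      qed
    qed (use M \<delta> y x assms(1) in \<open>auto simp: M_def\<close>)
    moreover have "(norm (x - a))\<^sup>2 \<le> (R / 2)\<^sup>2" using x by (intro power_mono) auto
    then have "R\<^sup>2 - (norm (x - a))\<^sup>2 \<ge> 3 / 4 * R\<^sup>2" by (simp add: power_divide)
    then have "\<delta> * M ^ 3 / 6 * (R\<^sup>2 - (norm (x - a))\<^sup>2) \<ge> \<delta> * M ^ 3 / 6 * (3 / 4 * R\<^sup>2)"
      using \<delta> M by (intro mult_left_mono) auto
    ultimately show ?thesis by (simp add: c_def)
  qed
  have "c / 2 \<le> M"
  proof (cases "norm (y - a) \<le> R / 2")
    case True
    then show ?thesis using cw[OF True] c by (simp add: M_def)
  next
    case False
    then have "c * (R / 2) / norm (y - a) \<le> w y"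
      using assms(1) c cw by (intro inverse_radius_lower_bound) auto
    moreover have "norm (y - a) > 0" using False assms(1) by linarith
    then have "c * (R / 2) / R \<le> c * (R / 2) / norm (y - a)"
      using False y(1) assms(1) c by (intro divide_left_mono) auto
    moreover have "c * (R / 2) / R = c / 2" using assms(1) by simp
    ultimately show ?thesis unfolding M_def by linarith
  qed
  then have "M * (\<delta> * (M * R)\<^sup>2) \<le> M * 8"
    by (simp add: c_def power2_eq_square power3_eq_cube algebra_simps)
  then have "\<delta> * (M * R)\<^sup>2 \<le> 8" using M by simp
  moreover have "(m * R)\<^sup>2 \<le> (M * R)\<^sup>2"
    using \<open>m \<le> M\<close> assms(1,2) by (intro power_mono mult_right_mono) auto
  then have "\<delta> * (m * R)\<^sup>2 \<le> \<delta> * (M * R)\<^sup>2" using \<delta> by simp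
  ultimately show ?thesis by linarith
qed

text \<open>
  Evaluating both bounds on the sphere of radius \<open>R = \<rho> exp T\<close> gives \<open>\<delta> (A T)\<^sup>2 \<le> 8\<close> for all
  \<open>T > 0\<close>.
\<close>

lemma vanishes: "w a = 0"
proof (rule ccontr)
  assume "w a \<noteq> 0"
  then have wa: "w a > 0" using nonneg[of a] by linarith
  have "isCont w a" using cont by (simp add: continuous_on_eq_continuous_at)
  then have "\<forall>\<^sub>F x in nhds a. w a / 2 < w x"
    using wa unfolding isCont_def tendsto_at_iff_tendsto_nhds
    by (intro order_tendstoD(1)[where y = "w a"]) auto
  then obtain e where e: "e > 0" "\<And>x. dist x a < e \<Longrightarrow> w a / 2 < w x"
    unfolding eventually_nhds_metric by auto
  define \<rho> where "\<rho> = e / 2"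
  have \<rho>: "\<rho> > 0" "\<And>x. norm (x - a) = \<rho> \<Longrightarrow> w a / 2 \<le> w x"
    using e by (auto simp: \<rho>_def dist_norm intro!: less_imp_le)
  define b where "b = w a / 2 * \<rho>"
  have b: "b > 0" using wa \<rho> by (simp add: b_def)
  have bw: "b / norm (x - a) \<le> w x" if "\<rho> \<le> norm (x - a)" for x
    using inverse_radius_lower_bound[OF \<rho>(1) _ \<rho>(2) that] wa by (simp add: b_def)
  define A where "A = \<delta> * b ^ 3 / 3"
  have A: "A > 0" using \<delta> b by (simp add: A_def)
  have bound: "\<delta> * (A * T)\<^sup>2 \<le> 8" if T: "T > 0" for T
  proof -
    define R where "R = \<rho> * exp T"
    have R: "R > 0" "R \<ge> \<rho>" "ln (R / \<rho>) = T" using \<rho>(1) T by (auto simp: R_def)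
    have "\<delta> * (A * T / R * R)\<^sup>2 \<le> 8"
    proof (rule universal_upper_bound[where a = a])
      show "A * T / R \<le> w x" if "norm (x - a) = R" for x
        using logarithmic_lower_bound[OF \<rho>(1) less_imp_le[OF b] bw, of x] that R
        by (simp add: A_def)
    qed (use R A T in auto)
    then show ?thesis using R by simp
  qed
  have "filterlim (\<lambda>T. \<delta> * (A * T)\<^sup>2) at_top at_top"
    using \<delta> A by real_asymp
  then have "\<forall>\<^sub>F T in at_top. \<delta> * (A * T)\<^sup>2 > 8"
    by (simp add: filterlim_at_top_dense)
  then have "\<forall>\<^sub>F T::real in at_top. False"
    using eventually_gt_at_top[of 0] by eventually_elim (use bound in force)
  then show False by simp
qed

end

section \<open>Cubic copositivity\<close>

definition weighted_cubic_form :: "real ^ 'n ^ 'n \<Rightarrow> real ^ 'n \<Rightarrow> real ^ 'n \<Rightarrow> real" where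
  "weighted_cubic_form B \<mu> c =
     (\<Sum>i\<in>UNIV. \<Sum>j\<in>UNIV. B $ i $ j * (c $ j)\<^sup>2 * c $ i * \<mu> $ i)"

text \<open>
  The form is homogeneous of degree 3, so \<open>\<kappa>\<close> can be taken to be its minimum over the compact set of
  unit vectors in the cone.
\<close>

lemma strictly_cubically_copositive_coercive:
  fixes B :: "real ^ 'n ^ 'n"
  assumes "strictly_cubically_copositive B"
  obtains \<mu> \<kappa> where "\<mu> \<in> nonneg_cone" "\<kappa> > 0"
    "\<And>c. c \<in> nonneg_cone \<Longrightarrow> \<kappa> * norm c ^ 3 \<le> weighted_cubic_form B \<mu> c"
proof -
  obtain \<mu> where \<mu>: "\<mu> \<in> nonneg_cone"
    "\<And>c. c \<in> nonneg_cone \<Longrightarrow> c \<noteq> 0 \<Longrightarrow> weighted_cubic_form B \<mu> c > 0"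
    using assms unfolding strictly_cubically_copositive_def weighted_cubic_form_def by auto
  let ?S = "sphere 0 1 \<inter> nonneg_cone :: (real ^ 'n) set"
  have "closed (nonneg_cone :: (real ^ 'n) set)"
    unfolding nonneg_cone_def by (intro closed_Collect_all closed_Collect_le continuous_intros)
  then have "compact ?S" by (simp add: compact_Int_closed)
  moreover have "axis k 1 \<in> ?S" for k by (auto simp: nonneg_cone_def axis_def norm_axis_1[unfolded axis_def])
  then have "?S \<noteq> {}" by blast
  moreover have "continuous_on ?S (weighted_cubic_form B \<mu>)"
    unfolding weighted_cubic_form_def by (intro continuous_intros)
  ultimately obtain s where s: "s \<in> ?S"
    "\<And>c. c \<in> ?S \<Longrightarrow> weighted_cubic_form B \<mu> s \<le> weighted_cubic_form B \<mu> c"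
    using continuous_attains_inf by metis
  have "weighted_cubic_form B \<mu> s * norm c ^ 3 \<le> weighted_cubic_form B \<mu> c"
    if c: "c \<in> nonneg_cone" for c
  proof (cases "c = 0")
    case False
    define d where "d = (1 / norm c) *\<^sub>R c"
    have "d \<in> ?S" using c False by (auto simp: d_def nonneg_cone_def)
    have "c = norm c *\<^sub>R d" using False by (simp add: d_def)
    then have "weighted_cubic_form B \<mu> c = weighted_cubic_form B \<mu> (norm c *\<^sub>R d)" by simp
    also have "\<dots> = norm c ^ 3 * weighted_cubic_form B \<mu> d"
      by (simp add: weighted_cubic_form_def sum_distrib_left power2_eq_square power3_eq_cube
          algebra_simps)
    finally show ?thesis using s(2)[OF \<open>d \<in> ?S\<close>]
      by (simp add: mult.commute[of _ "norm c ^ 3"] mult_left_mono)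
  qed (simp add: weighted_cubic_form_def)
  moreover have "weighted_cubic_form B \<mu> s > 0" using s(1) by (intro \<mu>(2)) auto
  ultimately show ?thesis using that \<mu>(1) by blast
qed

lemma cubic_young:
  fixes x y :: real
  assumes "0 \<le> x" "0 \<le> y"
  shows "3 * (x\<^sup>2 * y) \<le> 2 * x ^ 3 + y ^ 3"
proof -
  have "2 * x ^ 3 + y ^ 3 - 3 * (x\<^sup>2 * y) = (x - y)\<^sup>2 * (2 * x + y)"
    by (simp add: power2_eq_square power3_eq_cube algebra_simps)
  also have "\<dots> \<ge> 0" using assms by simp
  finally show ?thesis by simp
qed

text \<open>
  Young's inequality replaces \<open>c\<^sub>j\<^sup>2 c\<^sub>i\<close> by \<open>(2 c\<^sub>j\<^sup>3 + c\<^sub>i\<^sup>3) / 3\<close> in the terms with a nonpositive coefficient.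
  Symmetry is what lets the two cubes be recombined into the single row sum of each
  \<open>i\<close>, which is positive by diagonal dominance.
\<close>

lemma diagonally_dominant_imp_strictly_cubically_copositive:
  fixes B :: "real ^ 'n ^ 'n"
  assumes sym: "transpose B = B"
    and dom: "\<And>i. (\<Sum>j\<in>UNIV - {i}. min (B $ i $ j) 0) > - (B $ i $ i)"
  shows "strictly_cubically_copositive B"
  unfolding strictly_cubically_copositive_def
proof (intro bexI ballI)
  show "(\<chi> i. 1) \<in> nonneg_cone" by (simp add: nonneg_cone_def)
  fix c :: "real ^ 'n" assume "c \<in> nonneg_cone - {0}"
  then have c: "\<And>i. c $ i \<ge> 0" and "c \<noteq> 0" by (auto simp: nonneg_cone_def)
  then obtain k where k: "c $ k > 0" by (metis less_eq_real_def vec_eq_iff zero_index)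
  define b where "b i j = (if j = i then B $ i $ i else min (B $ i $ j) 0)" for i j
  have Bsym: "B $ i $ j = B $ j $ i" for i j
    using arg_cong[OF sym, of "\<lambda>A. A $ j $ i"] by (simp add: transpose_def)
  then have b_sym: "b i j = b j i" for i j by (simp add: b_def)
  have row: "(\<Sum>j\<in>UNIV. b i j) > 0" for i
  proof -
    have "(\<Sum>j\<in>UNIV. b i j) = b i i + (\<Sum>j\<in>UNIV - {i}. b i j)"
      by (rule sum.remove) auto
    also have "(\<Sum>j\<in>UNIV - {i}. b i j) = (\<Sum>j\<in>UNIV - {i}. min (B $ i $ j) 0)"
      by (rule sum.cong) (auto simp: b_def)
    finally show ?thesis using dom[of i] by (simp add: b_def)
  qed
  have "0 < (\<Sum>i\<in>UNIV. (\<Sum>j\<in>UNIV. b i j) * c $ i ^ 3)"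
  proof (rule sum_pos2[of _ k])
    show "0 \<le> (\<Sum>j\<in>UNIV. b i j) * c $ i ^ 3" for i
      using row[of i] c[of i] by (intro mult_nonneg_nonneg) auto
  qed (use row k in auto)
  also have "\<dots> = (\<Sum>i\<in>UNIV. \<Sum>j\<in>UNIV. b i j * ((2 * c $ j ^ 3 + c $ i ^ 3) / 3))"
  proof -
    have "(\<Sum>i\<in>UNIV. \<Sum>j\<in>UNIV. b i j * c $ j ^ 3) = (\<Sum>j\<in>UNIV. \<Sum>i\<in>UNIV. b i j * c $ j ^ 3)"
      by (rule sum.swap)
    also have "\<dots> = (\<Sum>i\<in>UNIV. \<Sum>j\<in>UNIV. b i j * c $ i ^ 3)"
      by (intro sum.cong refl) (metis b_sym)
    finally have swap: "(\<Sum>i\<in>UNIV. \<Sum>j\<in>UNIV. b i j * c $ j ^ 3) =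
        (\<Sum>i\<in>UNIV. \<Sum>j\<in>UNIV. b i j * c $ i ^ 3)" .
    have "(\<Sum>i\<in>UNIV. \<Sum>j\<in>UNIV. b i j * ((2 * c $ j ^ 3 + c $ i ^ 3) / 3)) =
        2 / 3 * (\<Sum>i\<in>UNIV. \<Sum>j\<in>UNIV. b i j * c $ j ^ 3) +
        1 / 3 * (\<Sum>i\<in>UNIV. \<Sum>j\<in>UNIV. b i j * c $ i ^ 3)"
      by (simp only: sum_distrib_left sum.distrib[symmetric])
        (intro sum.cong refl, simp add: algebra_simps add_divide_distrib)
    then show ?thesis unfolding swap by (simp add: sum_distrib_right)
  qed
  also have "\<dots> \<le> (\<Sum>i\<in>UNIV. \<Sum>j\<in>UNIV. B $ i $ j * (c $ j)\<^sup>2 * c $ i * (\<chi> i. 1) $ i)"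
  proof (intro sum_mono)
    fix i j
    show "b i j * ((2 * c $ j ^ 3 + c $ i ^ 3) / 3) \<le> B $ i $ j * (c $ j)\<^sup>2 * c $ i * (\<chi> i. 1) $ i"
    proof (cases "j = i")
      case True
      then show ?thesis by (simp add: b_def power2_eq_square power3_eq_cube)
    next
      case False
      have "b i j * ((2 * c $ j ^ 3 + c $ i ^ 3) / 3) \<le> b i j * ((c $ j)\<^sup>2 * c $ i)"
        using False cubic_young[of "c $ j" "c $ i"] c
        by (intro mult_left_mono_neg) (auto simp: b_def)
      also have "\<dots> \<le> B $ i $ j * ((c $ j)\<^sup>2 * c $ i)"
        using False c by (intro mult_right_mono) (auto simp: b_def)
      finally show ?thesis by (simp add: mult.assoc)
    qed
  qed
  finally show "(\<Sum>i\<in>UNIV. \<Sum>j\<in>UNIV. B $ i $ j * (c $ j)\<^sup>2 * c $ i * (\<chi> i. 1) $ i) > 0" .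
qed

text \<open>
  The weighted sum \<open>w\<close> is a supersolution because Cauchy-Schwarz gives \<open>w \<le> |\<mu>| |u|\<close>, so that the
  coercive bound \<open>\<kappa> |u|\<^sup>3\<close> dominates a multiple of \<open>w\<^sup>3\<close>. After \<open>w\<close> is known to vanish, the same bound is
  used once more, now for \<open>u\<close> itself.
\<close>

lemma strictly_cubically_copositive_imp_trivial:
  fixes B :: "real ^ 'n ^ 'n" and u :: "'n \<Rightarrow> real ^ 'm \<Rightarrow> real"
  assumes "strictly_cubically_copositive B" "CARD('m) \<le> 3"
    and sol: "nonneg_cubic_system_solution B u"
  shows "u i x = 0"
proof -
  obtain \<mu> \<kappa> where \<mu>: "\<mu> \<in> nonneg_cone" and \<kappa>: "\<kappa> > 0"
    and coercive: "\<And>c. c \<in> nonneg_cone \<Longrightarrow> \<kappa> * norm c ^ 3 \<le> weighted_cubic_form B \<mu> c"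
    using strictly_cubically_copositive_coercive[OF assms(1)] by metis
  define c where "c x = (\<chi> i. u i x)" for x
  define w where "w x = (\<Sum>i\<in>UNIV. \<mu> $ i * u i x)" for x
  define D where "D x = (\<Sum>i\<in>UNIV. \<mu> $ i * laplacian (u i) x)" for x
  have u: "\<And>i. C2_function (u i)" "\<And>i x. 0 \<le> u i x"
    "\<And>i x. - laplacian (u i) x = (\<Sum>j\<in>UNIV. B $ i $ j * (u j x)\<^sup>2 * u i x)"
    using sol unfolding nonneg_cubic_system_solution_def by auto
  have \<mu>0: "\<mu> $ i \<ge> 0" for i using \<mu> by (simp add: nonneg_cone_def)
  have "- D x = weighted_cubic_form B \<mu> (c x)" for x
  proof -
    have "- D x = (\<Sum>i\<in>UNIV. \<mu> $ i * (- laplacian (u i) x))"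
      by (simp add: D_def sum_negf)
    then show ?thesis
      by (simp add: u(3) weighted_cubic_form_def c_def sum_distrib_left mult.commute
          mult.left_commute)
  qed
  then have D: "\<kappa> * norm (c x) ^ 3 \<le> - D x" for x
    using coercive[of "c x"] u(2) by (simp add: c_def nonneg_cone_def)
  have w_nonneg: "0 \<le> w x" for x
    unfolding w_def using \<mu>0 u(2) by (simp add: sum_nonneg)
  \<comment> \<open>the summand 1 only keeps \<open>C\<close> positive, as it becomes a divisor\<close>
  define C where "C = norm \<mu> + 1"
  have C: "C > 0" by (simp add: C_def add_nonneg_pos)
  have w_le: "w x \<le> C * norm (c x)" for x
  proof -
    have "w x = \<mu> \<bullet> c x" by (simp add: w_def c_def inner_vec_def)
    also have "\<dots> \<le> norm \<mu> * norm (c x)" by (rule norm_cauchy_schwarz)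
    also have "\<dots> \<le> C * norm (c x)" by (intro mult_right_mono) (auto simp: C_def)
    finally show ?thesis .
  qed
  interpret cubic_supersolution w D "\<kappa> / C ^ 3"
  proof
    show "continuous_on UNIV w"
      unfolding w_def using u(1)
      by (intro continuous_intros differentiable_imp_continuous_on) (auto simp: C2_function_def)
    show "has_laplacian w (D x) x" for x
      unfolding w_def D_def
      by (intro has_laplacian_sum has_laplacian_cmult C2_function_has_laplacian u(1)) auto
    show "\<kappa> / C ^ 3 * w x ^ 3 \<le> - D x" for x
    proof -
      have "w x ^ 3 \<le> (C * norm (c x)) ^ 3" by (intro power_mono w_le w_nonneg)
      then have "\<kappa> / C ^ 3 * w x ^ 3 \<le> \<kappa> / C ^ 3 * (C * norm (c x)) ^ 3"
        using \<kappa> C by (intro mult_left_mono) auto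
      also have "\<dots> = \<kappa> * norm (c x) ^ 3" using C by (simp add: power_mult_distrib)
      finally show ?thesis using D[of x] by linarith
    qed
  qed (use assms(2) w_nonneg \<kappa> C in auto)
  have "w = (\<lambda>x. 0)" using vanishes by blast
  then have "has_laplacian (\<lambda>x. 0) (D x) x" using lap[of x] by simp
  from laplacian_nonneg_at_local_min[OF this open_UNIV]
  have "D x \<ge> 0" by simp
  then have "\<kappa> * norm (c x) ^ 3 \<le> 0" using D[of x] by linarith
  then have "norm (c x) ^ 3 \<le> 0" using \<kappa> by (simp add: mult_le_0_iff)
  then have "c x = 0" by (metis norm_le_zero_iff not_le zero_less_power)
  then show ?thesis by (simp add: c_def vec_eq_iff)
qed

theorem proposition1p3:
  fixes B :: "real ^ 'n ^ 'n"
  assumes "transpose B = B"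
    and "\<And>i. B $ i $ i > 0"
    and "\<And>i. (\<Sum>j\<in>UNIV - {i}. min (B $ i $ j) 0) > - (B $ i $ i)"
  shows "strictly_cubically_copositive B \<and>
    (CARD('m::finite) \<in> {1, 2, 3} \<longrightarrow>
      \<not> (\<exists>u :: 'n \<Rightarrow> real ^ 'm \<Rightarrow> real.
            nonneg_cubic_system_solution B u \<and> nontrivial u))"
proof (intro conjI impI notI)
  show copos: "strictly_cubically_copositive B"
    by (rule diagonally_dominant_imp_strictly_cubically_copositive[OF assms(1,3)])
  assume dim: "CARD('m) \<in> {1, 2, 3}"
    and "\<exists>u :: 'n \<Rightarrow> real ^ 'm \<Rightarrow> real. nonneg_cubic_system_solution B u \<and> nontrivial u"
  then obtain u :: "'n \<Rightarrow> real ^ 'm \<Rightarrow> real"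
    where u: "nonneg_cubic_system_solution B u" "nontrivial u" by blast
  have "CARD('m) \<le> 3" using dim by auto
  then have "u i x = 0" for i x
    using strictly_cubically_copositive_imp_trivial[OF copos _ u(1)] by blast
  then show False using u(2) by (auto simp: nontrivial_def)
qed

end
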